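(* Let $n,m$ be integers, with $n,m\ge 2$ for directed cycles, trees and complete digraphs and $n,m\ge 3$ for symmetric cycles. Then the following values hold (with $T$ any tree of the indicated order): (i) $\lambda_2(\overrightarrow{C}_n\Box\overrightarrow{C}_m)=2$, $\lambda_2(\overrightarrow{C}_n\Box\overleftrightarrow{C}_m)=3$, $\lambda_2(\overrightarrow{C}_n\Box\overleftrightarrow{T}_m)=2$, $\lambda_2(\overrightarrow{C}_n\Box\overleftrightarrow{K}_m)=m$; (ii) $\lambda_2(\overleftrightarrow{C}_n\Box\overrightarrow{C}_m)=3$, $\lambda_2(\overleftrightarrow{C}_n\Box\overleftrightarrow{C}_m)=4$, $\lambda_2(\overleftrightarrow{C}_n\Box\overleftrightarrow{T}_m)=3$, $\lambda_2(\overleftrightarrow{C}_n\Box\overleftrightarrow{K}_m)=m+1$; (iii) $\lambda_2(\overleftrightarrow{T}_n\Box\overrightarrow{C}_m)=2$, $\lambda_2(\overleftrightarrow{T}_n\Box\overleftrightarrow{C}_m)=3$, $\lambda_2(\overleftrightarrow{T}_n\Box\overleftrightarrow{T}_m)=2$, $\lambda_2(\overleftrightarrow{T}_n\Box\overleftrightarrow{K}_m)=m$; (iv) $\lambda_2(\overleftrightarrow{K}_n\Box\overrightarrow{C}_m)=n$, $\lambda_2(\overleftrightarrow{K}_n\Box\overleftrightarrow{C}_m)=n+1$, $\lambda_2(\overleftrightarrow{K}_n\Box\overleftrightarrow{T}_m)=n$, $\lambda_2(\overleftrightarrow{K}_n\Box\overleftrightarrow{K}_m)=n+m-2$.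
   Context: $\overrightarrow{C}_n$ is the directed cycle of order $n$; $\overleftrightarrow{C}_n$ is the symmetric digraph obtained from the undirected cycle of order $n$ by replacing each edge by two opposite arcs; $\overleftrightarrow{T}_n$ is the symmetric digraph of an undirected tree of order $n$; $\overleftrightarrow{K}_n$ is the complete digraph of order $n$. For a digraph $D$ and $S\subseteq V(D)$, an $S$-strong subgraph is a strongly connected subgraph of $D$ containing all vertices of $S$; $\lambda_S(D)$ is the maximum number of pairwise arc-disjoint $S$-strong subgraphs of $D$; and $\lambda_2(D)=\min\{\lambda_S(D): S\subseteq V(D),\ |S|=2\}$. The Cartesian product $G\Box H$ has vertex set $V(G)\times V(H)$, and $(x,x')(y,y')$ is an arc iff either $xy\in A(G)$ and $x'=y'$, or $x=y$ and $x'y'\in A(H)$. *)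

theory Defs
  imports "Graph_Theory.Graph_Theory"
begin

definition dicycle :: "nat \<Rightarrow> nat pair_pre_digraph" where
  "dicycle n = \<lparr> pverts = {..<n}, parcs = {(i, (i + 1) mod n) | i. i < n} \<rparr>"

definition sym_cycle :: "nat \<Rightarrow> nat pair_pre_digraph" where
  "sym_cycle n = mk_symmetric (with_proj (dicycle n))"

definition sym_complete :: "nat \<Rightarrow> nat pair_pre_digraph" where
  "sym_complete n = \<lparr> pverts = {..<n}, parcs = {(i, j). i < n \<and> j < n \<and> i \<noteq> j} \<rparr>"

text \<open>
  As in the library, a finite simple undirected graph is identified with its symmetric
  digraph (\<^locale>\<open>pair_graph\<close>).  The library predicate \<^const>\<open>tree\<close> cannot be used for the
  symmetric digraph of a tree, because it already counts a pair of opposite arcs as a cycle.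
  The cycles of the underlying undirected graph are exactly the directed cycles of length at
  least 3 of the symmetric digraph.
\<close>

definition sym_tree :: "nat \<Rightarrow> 'a pair_pre_digraph \<Rightarrow> bool" where
  "sym_tree n T \<longleftrightarrow> pair_graph T \<and> card (pverts T) = n \<and> connected (with_proj T) \<and>
     \<not> (\<exists>p. pre_digraph.cycle (with_proj T) p \<and> 3 \<le> length p)"

definition cart_prod ::
    "'a pair_pre_digraph \<Rightarrow> 'b pair_pre_digraph \<Rightarrow> ('a \<times> 'b) pair_pre_digraph" (infixl \<open>\<box>\<close> 70) where
  "G \<box> H = \<lparr> pverts = pverts G \<times> pverts H,
     parcs = {((x, x'), (y, y')) | x x' y y'.
       (x, x') \<in> pverts G \<times> pverts H \<and> (y, y') \<in> pverts G \<times> pverts H \<and>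
       ((x, y) \<in> parcs G \<and> x' = y' \<or> x = y \<and> (x', y') \<in> parcs H)} \<rparr>"

definition strong_subgraph ::
    "'a set \<Rightarrow> 'a pair_pre_digraph \<Rightarrow> 'a pair_pre_digraph \<Rightarrow> bool" where
  "strong_subgraph S D H \<longleftrightarrow>
     subgraph (with_proj H) (with_proj D) \<and> strongly_connected (with_proj H) \<and> S \<subseteq> pverts H"

definition arc_disjoint_strong_family ::
    "'a set \<Rightarrow> 'a pair_pre_digraph \<Rightarrow> 'a pair_pre_digraph set \<Rightarrow> bool" where
  "arc_disjoint_strong_family S D F \<longleftrightarrow>
     (\<forall>H\<in>F. strong_subgraph S D H) \<and> pairwise (\<lambda>H H'. parcs H \<inter> parcs H' = {}) F"

text \<open>For finite \<open>D\<close> both extrema below are over finite sets; the first one is never empty, the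
  second one is nonempty as soon as \<open>D\<close> has two vertices.\<close>

definition lambda_S :: "'a set \<Rightarrow> 'a pair_pre_digraph \<Rightarrow> nat" where
  "lambda_S S D = Max {card F | F. arc_disjoint_strong_family S D F}"

definition lambda2 :: "'a pair_pre_digraph \<Rightarrow> nat" where
  "lambda2 D = Min {lambda_S S D | S. S \<subseteq> pverts D \<and> card S = 2}"

lemma complete_digraph_sym_complete: "complete_digraph n (with_proj (sym_complete n))"
  by (auto simp: complete_digraph_pair_def sym_complete_def)

end

theory Submission
  imports Defs "HOL-Library.Disjoint_Sets"
begin

text \<open>
  An arc set contains the arcs of a strong subgraph through \<open>x\<close> and \<open>y\<close> iff \<open>x\<close> and \<open>y\<close> reach each
  other along its arcs, so \<open>\<lambda>\<^sub>2\<close> counts disjoint arc sets with this property. Using copies of the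
  two factors as rows and columns, such families in \<open>G\<close> and \<open>H\<close> of sizes \<open>p\<close> and \<open>q\<close> combine to one
  of size \<open>p + q\<close> in \<open>G \<box> H\<close>. Conversely every strong subgraph through \<open>v\<close> and another vertex uses
  an arc leaving \<open>v\<close>, so \<open>\<lambda>\<^sub>2\<close> is at most the smallest out-degree. Directed cycles, symmetric cycles,
  trees and complete digraphs attain their smallest out-degrees 1, 2, 1 and \<open>n - 1\<close>, and
  out-degrees add up in the product.
\<close>

section \<open>Linking families of arc sets\<close>

text \<open>Only arcs are recorded. The vertex set is recovered later as a strong component, so that
  subgraphs can be replaced by arc sets.\<close>

definition mutually_reachable :: "'a rel \<Rightarrow> 'a \<Rightarrow> 'a \<Rightarrow> bool" where
  "mutually_reachable A x y \<longleftrightarrow> (x, y) \<in> A\<^sup>* \<and> (y, x) \<in> A\<^sup>*"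

text \<open>The index type is left free: at different places the indices are numbers, elements of a
  sum type, vertices, or the subgraphs themselves.\<close>

definition linking_family ::
    "'i set \<Rightarrow> ('i \<Rightarrow> 'a rel) \<Rightarrow> 'a rel \<Rightarrow> 'a \<Rightarrow> 'a \<Rightarrow> bool" where
  "linking_family I A E x y \<longleftrightarrow>
     disjoint_family_on A I \<and> (\<forall>i\<in>I. A i \<subseteq> E \<and> mutually_reachable (A i) x y)"

text \<open>The counterpart, in terms of arc sets, of the lower bound
  \<open>k \<le> lambda2 D\<close>.\<close>

definition arc_linked :: "nat \<Rightarrow> 'a pair_pre_digraph \<Rightarrow> bool" where
  "arc_linked k D \<longleftrightarrow> (\<forall>x\<in>pverts D. \<forall>y\<in>pverts D. x \<noteq> y \<longrightarrow>
     (\<exists>A. linking_family {..<k} A (parcs D) x y))"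

section \<open>Basic properties of mutual reachability and of linking families\<close>

lemma mutually_reachable_sym: "mutually_reachable A x y \<Longrightarrow> mutually_reachable A y x"
  by (simp add: mutually_reachable_def)

lemma mutually_reachable_trans [trans]:
  "mutually_reachable A x y \<Longrightarrow> mutually_reachable A y z \<Longrightarrow> mutually_reachable A x z"
  by (auto simp: mutually_reachable_def)

lemma mutually_reachable_mono:
  "mutually_reachable A x y \<Longrightarrow> A \<subseteq> B \<Longrightarrow> mutually_reachable B x y"
  using rtrancl_mono[of A B] by (auto simp: mutually_reachable_def)

lemma rtrancl_image:
  assumes "(x, y) \<in> A\<^sup>*"
  shows "(f x, f y) \<in> (map_prod f f ` A)\<^sup>*"
  using assms
proof induction
  case (step y z)
  then have "(f y, f z) \<in> map_prod f f ` A" by (force simp: map_prod_def)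
  with step.IH show ?case by (rule rtrancl_into_rtrancl)
qed simp

lemma mutually_reachable_image:
  "mutually_reachable A x y \<Longrightarrow> mutually_reachable (map_prod f f ` A) (f x) (f y)"
  by (simp add: mutually_reachable_def rtrancl_image)

text \<open>Loops at \<open>x\<close> with which a walk may start are skipped, so the first arc kept
  goes to another vertex.\<close>

lemma rtrancl_leaving_arc:
  assumes "(x, y) \<in> A\<^sup>*" and "x \<noteq> y"
  shows "\<exists>a. a \<noteq> x \<and> (x, a) \<in> A \<and> (a, y) \<in> A\<^sup>*"
  using assms by (induction rule: converse_rtrancl_induct) (metis, metis)

lemma linking_family_bij:
  assumes "linking_family I A E x y" and "bij_betw f J I"
  shows "linking_family J (\<lambda>j. A (f j)) E x y"
  using assms unfolding linking_family_def disjoint_family_on_def bij_betw_def inj_on_def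
  by blast

lemma linking_family_reindex:
  assumes "linking_family I A E x y" and "finite I" and "card I = k"
  shows "\<exists>B. linking_family {..<k} B E x y"
proof -
  obtain f where "bij_betw f {..<k} I"
    using ex_bij_betw_nat_finite[OF assms(2)] assms(3) by (auto simp: atLeast0LessThan)
  then show ?thesis using linking_family_bij[OF assms(1)] by blast
qed

text \<open>The sum of the index sets joins the \<open>p\<close> routes and the \<open>q\<close>
  routes of a product without renumbering.\<close>

lemma linking_family_Plus:
  assumes "linking_family I A E x y" and "linking_family J B E x y"
    and "\<And>i j. i \<in> I \<Longrightarrow> j \<in> J \<Longrightarrow> A i \<inter> B j = {}"
  shows "linking_family (I <+> J) (case_sum A B) E x y"
  unfolding linking_family_def
proof (intro conjI)
  show "disjoint_family_on (case_sum A B) (I <+> J)"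
    using assms unfolding linking_family_def disjoint_family_on_def Plus_def
    by (simp add: ball_Un Int_commute)
  show "\<forall>i\<in>I <+> J. case_sum A B i \<subseteq> E \<and> mutually_reachable (case_sum A B i) x y"
    using assms by (simp add: linking_family_def Plus_def ball_Un)
qed

text \<open>Each member has to leave \<open>x\<close> by an arc of its own, and disjoint members
  cannot share such an arc, so the heads differ. The head \<open>a i\<close> gets back to
  \<open>x\<close> via \<open>y\<close>. In products the heads supply private rows and columns;
  counted at a single vertex they give the out-degree bound.\<close>

lemma linking_family_distinct_neighbours:
  assumes "linking_family I A E x y" and "x \<noteq> y"
  shows "\<exists>a. inj_on a I \<and>
    (\<forall>i\<in>I. a i \<noteq> x \<and> (x, a i) \<in> A i \<and> mutually_reachable (A i) x (a i))"
proof -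
  have "\<forall>i\<in>I. \<exists>a. a \<noteq> x \<and> (x, a) \<in> A i \<and> mutually_reachable (A i) x a"
  proof
    fix i assume "i \<in> I"
    then have r: "(x, y) \<in> (A i)\<^sup>*" "(y, x) \<in> (A i)\<^sup>*"
      using assms by (auto simp: linking_family_def mutually_reachable_def)
    obtain a where "a \<noteq> x" "(x, a) \<in> A i" "(a, y) \<in> (A i)\<^sup>*"
      using rtrancl_leaving_arc[OF r(1) assms(2)] by blast
    with r show "\<exists>a. a \<noteq> x \<and> (x, a) \<in> A i \<and> mutually_reachable (A i) x a"
      by (auto simp: mutually_reachable_def intro!: exI[of _ a])
  qed
  then obtain a where a: "\<And>i. i \<in> I \<Longrightarrow>
      a i \<noteq> x \<and> (x, a i) \<in> A i \<and> mutually_reachable (A i) x (a i)"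
    by metis
  moreover have "inj_on a I"
  proof (rule inj_onI, rule ccontr)
    fix i j assume "i \<in> I" "j \<in> I" "a i = a j" "i \<noteq> j"
    then have "(x, a i) \<in> A i \<inter> A j" using a[of i] a[of j] by simp
    moreover have "A i \<inter> A j = {}"
      using assms(1) \<open>i \<in> I\<close> \<open>j \<in> I\<close> \<open>i \<noteq> j\<close>
      by (simp add: linking_family_def disjoint_family_on_def)
    ultimately show False by simp
  qed
  ultimately show ?thesis by blast
qed

lemma arc_linked_mutually_reachable:
  assumes "arc_linked k D" and "1 \<le> k" and "x \<in> pverts D" and "y \<in> pverts D"
  shows "mutually_reachable (parcs D) x y"
proof (cases "x = y")
  case True
  then show ?thesis by (simp add: mutually_reachable_def)
next
  case False
  then obtain A where "linking_family {..<k} A (parcs D) x y"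
    using assms unfolding arc_linked_def by blast
  then have "A 0 \<subseteq> parcs D" "mutually_reachable (A 0) x y"
    using assms(2) by (auto simp: linking_family_def)
  then show ?thesis using mutually_reachable_mono by metis
qed


section \<open>Cartesian products\<close>

definition row :: "'a rel \<Rightarrow> 'b \<Rightarrow> ('a \<times> 'b) rel" where
  "row A c = map_prod (\<lambda>u. (u, c)) (\<lambda>u. (u, c)) ` A"

definition column :: "'b rel \<Rightarrow> 'a \<Rightarrow> ('a \<times> 'b) rel" where
  "column B c = map_prod (Pair c) (Pair c) ` B"

lemma mutually_reachable_row:
  "mutually_reachable A x y \<Longrightarrow> row A c \<subseteq> R \<Longrightarrow> mutually_reachable R (x, c) (y, c)"
  unfolding row_def by (drule mutually_reachable_image) (rule mutually_reachable_mono)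

lemma mutually_reachable_column:
  "mutually_reachable B x y \<Longrightarrow> column B c \<subseteq> R \<Longrightarrow> mutually_reachable R (c, x) (c, y)"
  unfolding column_def by (drule mutually_reachable_image) (rule mutually_reachable_mono)

lemma in_parcs_cart_prod_iff:
  assumes "pair_wf_digraph G" and "pair_wf_digraph H"
  shows "((x, x'), (y, y')) \<in> parcs (G \<box> H) \<longleftrightarrow>
    (x, y) \<in> parcs G \<and> x' = y' \<and> x' \<in> pverts H \<or> x = y \<and> x \<in> pverts G \<and> (x', y') \<in> parcs H"
  using pair_wf_digraph.wellformed'[OF assms(1)] pair_wf_digraph.wellformed'[OF assms(2)]
  by (auto simp: cart_prod_def)

lemma pverts_cart_prod [simp]: "pverts (G \<box> H) = pverts G \<times> pverts H"
  by (simp add: cart_prod_def)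

lemma row_subset_cart_prod:
  assumes "pair_wf_digraph G" and "pair_wf_digraph H" and "A \<subseteq> parcs G" and "c \<in> pverts H"
  shows "row A c \<subseteq> parcs (G \<box> H)"
  using assms by (auto simp: row_def in_parcs_cart_prod_iff)

lemma column_subset_cart_prod:
  assumes "pair_wf_digraph G" and "pair_wf_digraph H" and "B \<subseteq> parcs H" and "c \<in> pverts G"
  shows "column B c \<subseteq> parcs (G \<box> H)"
  using assms by (auto simp: column_def in_parcs_cart_prod_iff)

lemma pair_wf_digraph_cart_prod: "pair_wf_digraph (G \<box> H)"
  by unfold_locales (auto simp: cart_prod_def)

text \<open>Lets the case of a pair in a common column be deduced from that of a common row.\<close>

lemma linking_family_cart_prod_swap:
  assumes "pair_wf_digraph G" and "pair_wf_digraph H"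
    and "linking_family I A (parcs (H \<box> G)) (x', x) (y', y)"
  shows "linking_family I (\<lambda>i. map_prod prod.swap prod.swap ` A i) (parcs (G \<box> H)) (x, x') (y, y')"
proof -
  have inj: "inj (map_prod prod.swap prod.swap)"
    by (auto simp: inj_def)
  have "disjoint_family_on (\<lambda>i. map_prod prod.swap prod.swap ` A i) I"
    using assms(3) inj unfolding linking_family_def disjoint_family_on_def
    by (metis image_Int image_empty)
  moreover have "map_prod prod.swap prod.swap ` A i \<subseteq> parcs (G \<box> H)" if "i \<in> I" for i
    using assms that by (fastforce simp: linking_family_def in_parcs_cart_prod_iff)
  moreover have "mutually_reachable (map_prod prod.swap prod.swap ` A i) (x, x') (y, y')"
    if "i \<in> I" for i
    using mutually_reachable_image[of "A i" "(x', x)" "(y', y)" prod.swap] assms(3) that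
    by (simp add: linking_family_def)
  ultimately show ?thesis by (simp add: linking_family_def)
qed

lemma row_Int_row: "c \<noteq> d \<or> A \<inter> B = {} \<Longrightarrow> row A c \<inter> row B d = {}"
  by (auto simp: row_def)

lemma column_Int_column: "c \<noteq> d \<or> A \<inter> B = {} \<Longrightarrow> column A c \<inter> column B d = {}"
  by (auto simp: column_def)

text \<open>An arc in both a row and a column changes neither coordinate, so it would come from a
  loop of \<open>A\<close>.\<close>

lemma row_Int_column: "irrefl A \<Longrightarrow> row A c \<inter> column B d = {}"
  by (auto simp: row_def column_def irrefl_def)

lemma column_Int_row: "irrefl A \<Longrightarrow> column B d \<inter> row A c = {}"
  by (auto simp: row_def column_def irrefl_def)

lemmas row_column_disjoint = row_Int_row column_Int_column row_Int_column column_Int_row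

text \<open>The pair lies in one row: that row contains \<open>p\<close> strong subgraphs, and each of the \<open>q\<close>
  others goes along the two columns to a private row of its own and crosses there.\<close>

lemma linking_family_cart_prod_same_row:
  assumes G: "pair_digraph G" and H: "pair_digraph H"
    and "arc_linked p G" and "1 \<le> p" and "arc_linked q H"
    and "x \<in> pverts G" and "y \<in> pverts G" and "x \<noteq> y"
    and "c \<in> pverts H" and "d \<in> pverts H" and "c \<noteq> d"
  shows "\<exists>A. linking_family ({..<p} <+> {..<q}) A (parcs (G \<box> H)) (x, c) (y, c)"
proof -
  interpret G: pair_digraph G by fact
  interpret H: pair_digraph H by fact
  note wf = G.pair_wf_digraph H.pair_wf_digraph
  obtain A where A: "linking_family {..<p} A (parcs G) x y"
    using assms unfolding arc_linked_def by blast
  \<comment> \<open>\<open>d\<close> is any second vertex of \<open>H\<close>. It serves to obtain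
    \<open>q\<close> disjoint arc sets at \<open>c\<close>, whose first arcs lead to the rows
    \<open>b j\<close>.\<close>
  obtain B where B: "linking_family {..<q} B (parcs H) c d"
    using assms unfolding arc_linked_def by blast
  obtain b where b: "inj_on b {..<q}"
    "\<And>j. j < q \<Longrightarrow> b j \<noteq> c \<and> (c, b j) \<in> B j \<and> mutually_reachable (B j) c (b j)"
    using linking_family_distinct_neighbours[OF B \<open>c \<noteq> d\<close>] by auto
  have Bsub: "\<And>i. i < q \<Longrightarrow> B i \<subseteq> parcs H" and Asub: "\<And>i. i < p \<Longrightarrow> A i \<subseteq> parcs G"
    using A B by (auto simp: linking_family_def)
  have bH: "b j \<in> pverts H" if "j < q" for j
    using Bsub[OF that] b(2)[OF that] H.wellformed' by blast
  have irrG: "irrefl (parcs G)"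
    using G.no_loops' by (auto simp: irrefl_def)
  then have irrA: "irrefl (A i)" if "i < p" for i
    using Asub[OF that] by (auto simp: irrefl_def)
  \<comment> \<open>Route \<open>j\<close> follows \<open>B j\<close> in column \<open>x\<close> to
    row \<open>b j\<close>, crosses there with all arcs of \<open>G\<close>, and returns along
    \<open>B j\<close> in column \<open>y\<close>. Different routes are disjoint because the sets
    \<open>B j\<close> are disjoint and the rows \<open>b j\<close> differ; no route has a row arc
    in row \<open>c\<close>, as \<open>b j \<noteq> c\<close>.\<close>
  define R where "R j = column (B j) x \<union> row (parcs G) (b j) \<union> column (B j) y" for j
  have GG: "mutually_reachable (parcs G) x y"
    by (rule arc_linked_mutually_reachable[OF assms(3,4,6,7)])
  have Rlink: "mutually_reachable (R j) (x, c) (y, c)" if "j < q" for j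
  proof -
    have "mutually_reachable (R j) (x, c) (x, b j)"
      using b(2)[OF that] by (intro mutually_reachable_column[of "B j"]) (auto simp: R_def)
    also have "mutually_reachable (R j) (x, b j) (y, b j)"
      using GG by (intro mutually_reachable_row[of "parcs G"]) (auto simp: R_def)
    also have "mutually_reachable (R j) (y, b j) (y, c)"
      using b(2)[OF that] mutually_reachable_sym
      by (intro mutually_reachable_column[of "B j"]) (auto simp: R_def)
    finally show ?thesis .
  qed
  have "linking_family {..<p} (\<lambda>i. row (A i) c) (parcs (G \<box> H)) (x, c) (y, c)"
    using A wf \<open>c \<in> pverts H\<close>
    by (simp add: linking_family_def disjoint_family_on_def row_Int_row row_subset_cart_prod
        mutually_reachable_row[OF _ subset_refl])
  moreover have "linking_family {..<q} R (parcs (G \<box> H)) (x, c) (y, c)"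
    unfolding linking_family_def
  proof (intro conjI ballI)
    show "disjoint_family_on R {..<q}"
      unfolding disjoint_family_on_def
    proof (intro ballI impI)
      fix i j assume ij: "i \<in> {..<q}" "j \<in> {..<q}" "i \<noteq> j"
      then have "b i \<noteq> b j" "B i \<inter> B j = {}"
        using b(1) B by (auto simp: inj_on_def linking_family_def disjoint_family_on_def)
      then show "R i \<inter> R j = {}"
        by (simp add: R_def Int_Un_distrib Int_Un_distrib2 row_column_disjoint irrG)
    qed
  next
    fix j assume "j \<in> {..<q}"
    then show "R j \<subseteq> parcs (G \<box> H)"
      unfolding R_def using assms wf bH Bsub
      by (simp add: row_subset_cart_prod column_subset_cart_prod)
  qed (simp add: Rlink)
  moreover have "row (A i) c \<inter> R j = {}" if "i < p" "j < q" for i j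
  proof -
    have "c \<noteq> b j" using b(2)[OF that(2)] by blast
    with irrA[OF that(1)] show ?thesis
      by (simp add: R_def Int_Un_distrib row_column_disjoint)
  qed
  ultimately show ?thesis
    using linking_family_Plus[of "{..<p}" _ _ _ _ "{..<q}" R] by blast
qed

text \<open>The pair lies in different rows and columns. One member of each of the two given families,
  the one that may contain the arc to the other vertex, is used for the two routes around the
  rectangle spanned by the pair; the remaining members cross in private rows and columns, which
  avoid the rectangle.\<close>

lemma linking_family_cart_prod_skew:
  assumes G: "pair_digraph G" and H: "pair_digraph H"
    and "arc_linked p G" and "1 \<le> p" and "arc_linked q H" and "1 \<le> q"
    and "x \<in> pverts G" and "y \<in> pverts G" and "x \<noteq> y"
    and "x' \<in> pverts H" and "y' \<in> pverts H" and "x' \<noteq> y'"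
  shows "\<exists>A. linking_family ({..<p} <+> {..<q}) A (parcs (G \<box> H)) (x, x') (y, y')"
proof -
  interpret G: pair_digraph G by fact
  interpret H: pair_digraph H by fact
  note wf = G.pair_wf_digraph H.pair_wf_digraph
  \<comment> \<open>An injective \<open>a\<close> takes the value \<open>z\<close> at most once:
    choose that index, or any index if \<open>z\<close> is not taken; \<open>1 \<le> k\<close>
    supplies one.\<close>
  have avoid: "\<exists>i<k. \<forall>j<k. j \<noteq> i \<longrightarrow> a j \<noteq> z" if "inj_on a {..<k}" "1 \<le> k"
    for a :: "nat \<Rightarrow> 'c" and k z
    using that by (cases "\<exists>i<k. a i = z") (fastforce simp: inj_on_def)+
  obtain A where A: "linking_family {..<p} A (parcs G) x y"
    using assms unfolding arc_linked_def by blast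
  obtain B where B: "linking_family {..<q} B (parcs H) x' y'"
    using assms unfolding arc_linked_def by blast
  obtain a where a: "inj_on a {..<p}"
    "\<And>i. i < p \<Longrightarrow> a i \<noteq> x \<and> (x, a i) \<in> A i \<and> mutually_reachable (A i) x (a i)"
    using linking_family_distinct_neighbours[OF A \<open>x \<noteq> y\<close>] by auto
  obtain b where b: "inj_on b {..<q}"
    "\<And>j. j < q \<Longrightarrow> b j \<noteq> x' \<and> (x', b j) \<in> B j \<and> mutually_reachable (B j) x' (b j)"
    using linking_family_distinct_neighbours[OF B \<open>x' \<noteq> y'\<close>] by auto
  obtain i0 where i0: "i0 < p" "\<And>i. i < p \<Longrightarrow> i \<noteq> i0 \<Longrightarrow> a i \<noteq> y"
    using avoid[OF a(1) \<open>1 \<le> p\<close>] by blast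
  obtain j0 where j0: "j0 < q" "\<And>j. j < q \<Longrightarrow> j \<noteq> j0 \<Longrightarrow> b j \<noteq> y'"
    using avoid[OF b(1) \<open>1 \<le> q\<close>] by blast
  have Adis: "\<And>i j. i < p \<Longrightarrow> j < p \<Longrightarrow> i \<noteq> j \<Longrightarrow> A i \<inter> A j = {}"
    and Asub: "\<And>i. i < p \<Longrightarrow> A i \<subseteq> parcs G"
    and Alink: "\<And>i. i < p \<Longrightarrow> mutually_reachable (A i) x y"
    using A by (auto simp: linking_family_def disjoint_family_on_def)
  have Bdis: "\<And>i j. i < q \<Longrightarrow> j < q \<Longrightarrow> i \<noteq> j \<Longrightarrow> B i \<inter> B j = {}"
    and Bsub: "\<And>i. i < q \<Longrightarrow> B i \<subseteq> parcs H"
    and Blink: "\<And>i. i < q \<Longrightarrow> mutually_reachable (B i) x' y'"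
    using B by (auto simp: linking_family_def disjoint_family_on_def)
  have adis: "a i \<noteq> a j" if "i < p" "j < p" "i \<noteq> j" for i j
    using a(1) that by (auto simp: inj_on_def)
  have bdis: "b i \<noteq> b j" if "i < q" "j < q" "i \<noteq> j" for i j
    using b(1) that by (auto simp: inj_on_def)
  have aG: "a i \<in> pverts G" if "i < p" for i
    using Asub[OF that] a(2)[OF that] G.wellformed' by blast
  have bH: "b j \<in> pverts H" if "j < q" for j
    using Bsub[OF that] b(2)[OF that] H.wellformed' by blast
  have irrG: "irrefl (parcs G)"
    using G.no_loops' by (auto simp: irrefl_def)
  then have irrA: "irrefl (A i)" if "i < p" for i
    using Asub[OF that] by (auto simp: irrefl_def)
  have GG: "mutually_reachable (parcs G) x y"
    by (rule arc_linked_mutually_reachable[OF assms(3,4,7,8)])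
  have HH: "mutually_reachable (parcs H) x' y'"
    by (rule arc_linked_mutually_reachable[OF assms(5,6,10,11)])
  \<comment> \<open>\<open>P i0\<close> turns at the corner \<open>(y, x')\<close> and
    \<open>Q j0\<close> at \<open>(x, y')\<close>; between them they use the copies of
    \<open>A i0\<close> in rows \<open>x'\<close> and \<open>y'\<close> and of \<open>B j0\<close>
    in columns \<open>x\<close> and \<open>y\<close>. Every other \<open>P i\<close> crosses in
    column \<open>a i\<close>, every other \<open>Q j\<close> in row \<open>b j\<close>. No other
    route uses column arcs in that column or row arcs in that row, so all arcs of \<open>H\<close>
    or \<open>G\<close> are available there.\<close>
  define P where "P i = (if i = i0 then row (A i0) x' \<union> column (B j0) y
    else row (A i) x' \<union> column (parcs H) (a i) \<union> row (A i) y')" for i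
  define Q where "Q j = (if j = j0 then column (B j0) x \<union> row (A i0) y'
    else column (B j) x \<union> row (parcs G) (b j) \<union> column (B j) y)" for j
  have Plink: "mutually_reachable (P i) (x, x') (y, y')" if "i < p" for i
  proof (cases "i = i0")
    case True
    have "mutually_reachable (P i) (x, x') (y, x')"
      using True Alink[OF that] by (intro mutually_reachable_row[of "A i"]) (auto simp: P_def)
    also have "mutually_reachable (P i) (y, x') (y, y')"
      using True Blink[OF j0(1)]
      by (intro mutually_reachable_column[of "B j0"]) (auto simp: P_def)
    finally show ?thesis .
  next
    case False
    have ya: "mutually_reachable (A i) (a i) y"
      using a(2)[OF that] Alink[OF that] mutually_reachable_sym mutually_reachable_trans by metis
    have "mutually_reachable (P i) (x, x') (a i, x')"
      using False a(2)[OF that] by (intro mutually_reachable_row[of "A i"]) (auto simp: P_def)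
    also have "mutually_reachable (P i) (a i, x') (a i, y')"
      using False HH by (intro mutually_reachable_column[of "parcs H"]) (auto simp: P_def)
    also have "mutually_reachable (P i) (a i, y') (y, y')"
      using False ya by (intro mutually_reachable_row[of "A i"]) (auto simp: P_def)
    finally show ?thesis .
  qed
  have Qlink: "mutually_reachable (Q j) (x, x') (y, y')" if "j < q" for j
  proof (cases "j = j0")
    case True
    have "mutually_reachable (Q j) (x, x') (x, y')"
      using True Blink[OF that] by (intro mutually_reachable_column[of "B j"]) (auto simp: Q_def)
    also have "mutually_reachable (Q j) (x, y') (y, y')"
      using True Alink[OF i0(1)] by (intro mutually_reachable_row[of "A i0"]) (auto simp: Q_def)
    finally show ?thesis .
  next
    case False
    have yb: "mutually_reachable (B j) (b j) y'"
      using b(2)[OF that] Blink[OF that] mutually_reachable_sym mutually_reachable_trans by metis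
    have "mutually_reachable (Q j) (x, x') (x, b j)"
      using False b(2)[OF that] by (intro mutually_reachable_column[of "B j"]) (auto simp: Q_def)
    also have "mutually_reachable (Q j) (x, b j) (y, b j)"
      using False GG by (intro mutually_reachable_row[of "parcs G"]) (auto simp: Q_def)
    also have "mutually_reachable (Q j) (y, b j) (y, y')"
      using False yb by (intro mutually_reachable_column[of "B j"]) (auto simp: Q_def)
    finally show ?thesis .
  qed
  have "linking_family {..<p} P (parcs (G \<box> H)) (x, x') (y, y')"
    unfolding linking_family_def
  proof (intro conjI ballI)
    show "disjoint_family_on P {..<p}"
      unfolding disjoint_family_on_def
    proof (intro ballI impI)
      fix i j assume "i \<in> {..<p}" "j \<in> {..<p}" "i \<noteq> j"
      then have ij: "i < p" "j < p" "i \<noteq> j" by simp_all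
      have "a i \<noteq> a j" "A i \<inter> A j = {}" "irrefl (A i)" "irrefl (A j)" "irrefl (A i0)"
        "i \<noteq> i0 \<Longrightarrow> y \<noteq> a i" "j \<noteq> i0 \<Longrightarrow> a j \<noteq> y" "i \<noteq> i0 \<Longrightarrow> a i \<noteq> y" "j \<noteq> i0 \<Longrightarrow> y \<noteq> a j"
        using adis[OF ij] Adis[OF ij] irrA ij i0 by auto
      then show "P i \<inter> P j = {}"
        using ij(3) \<open>x' \<noteq> y'\<close> unfolding P_def
        by (cases "i = i0"; cases "j = i0")
          (simp_all add: Int_Un_distrib Int_Un_distrib2 row_column_disjoint)
    qed
  next
    fix i assume "i \<in> {..<p}"
    then show "P i \<subseteq> parcs (G \<box> H)"
      using assms wf aG Asub Bsub i0(1) j0(1) unfolding P_def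
      by (simp add: row_subset_cart_prod column_subset_cart_prod)
  qed (simp add: Plink)
  moreover have "linking_family {..<q} Q (parcs (G \<box> H)) (x, x') (y, y')"
    unfolding linking_family_def
  proof (intro conjI ballI)
    show "disjoint_family_on Q {..<q}"
      unfolding disjoint_family_on_def
    proof (intro ballI impI)
      fix i j assume "i \<in> {..<q}" "j \<in> {..<q}" "i \<noteq> j"
      then have ij: "i < q" "j < q" "i \<noteq> j" by simp_all
      have "b i \<noteq> b j" "B i \<inter> B j = {}" "irrefl (A i0)"
        "i \<noteq> j0 \<Longrightarrow> y' \<noteq> b i" "j \<noteq> j0 \<Longrightarrow> b j \<noteq> y'" "i \<noteq> j0 \<Longrightarrow> b i \<noteq> y'" "j \<noteq> j0 \<Longrightarrow> y' \<noteq> b j"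
        using bdis[OF ij] Bdis[OF ij] irrA ij i0 j0 by auto
      then show "Q i \<inter> Q j = {}"
        using ij(3) \<open>x \<noteq> y\<close> irrG unfolding Q_def
        by (cases "i = j0"; cases "j = j0")
          (simp_all add: Int_Un_distrib Int_Un_distrib2 row_column_disjoint)
    qed
  next
    fix j assume "j \<in> {..<q}"
    then show "Q j \<subseteq> parcs (G \<box> H)"
      using assms wf bH Asub Bsub i0(1) j0(1) unfolding Q_def
      by (simp add: row_subset_cart_prod column_subset_cart_prod)
  qed (simp add: Qlink)
  \<comment> \<open>Row arcs could meet only in row \<open>y'\<close>, where \<open>A i\<close>
    faces \<open>A i0\<close> with \<open>i \<noteq> i0\<close>; column arcs only in column
    \<open>y\<close>, where \<open>B j0\<close> faces \<open>B j\<close> with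
    \<open>j \<noteq> j0\<close>.\<close>
  moreover have "P i \<inter> Q j = {}" if "i < p" "j < q" for i j
  proof -
    have "irrefl (A i)" "irrefl (A i0)" "a i \<noteq> x" "x' \<noteq> b j"
      "i \<noteq> i0 \<Longrightarrow> a i \<noteq> y" "j \<noteq> j0 \<Longrightarrow> y' \<noteq> b j"
      "i \<noteq> i0 \<Longrightarrow> A i \<inter> A i0 = {}" "j \<noteq> j0 \<Longrightarrow> B j0 \<inter> B j = {}"
      using a(2)[OF that(1)] b(2)[OF that(2)] irrA that i0 j0 Adis Bdis by auto
    then show ?thesis
      using irrG \<open>x \<noteq> y\<close> \<open>x' \<noteq> y'\<close> unfolding P_def Q_def
      by (cases "i = i0"; cases "j = j0")
        (simp_all add: Int_Un_distrib Int_Un_distrib2 row_column_disjoint)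
  qed
  ultimately show ?thesis
    using linking_family_Plus[of "{..<p}" P _ _ _ "{..<q}" Q] by blast
qed

lemma card_ge_2_obtain_other:
  assumes "2 \<le> card V"
  obtains d where "d \<in> V" and "c \<noteq> d"
proof -
  have "\<not> V \<subseteq> {c}" using assms card_mono[of "{c}" V] by auto
  with that show ?thesis by blast
qed

text \<open>Pairs differing in both coordinates use the skew construction, pairs in a row the
  crossing one, and pairs in a column are turned into pairs in a row by exchanging the factors. The
  size hypotheses supply the auxiliary vertex \<open>d\<close> in the last two cases.\<close>

theorem arc_linked_cart_prod:
  assumes G: "pair_digraph G" and H: "pair_digraph H"
    and p: "arc_linked p G" "1 \<le> p" and q: "arc_linked q H" "1 \<le> q"
    and cardG: "2 \<le> card (pverts G)" and cardH: "2 \<le> card (pverts H)"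
  shows "arc_linked (p + q) (G \<box> H)"
  unfolding arc_linked_def
proof (intro ballI impI)
  fix s t assume "s \<in> pverts (G \<box> H)" "t \<in> pverts (G \<box> H)" "s \<noteq> t"
  then obtain x x' y y' where st: "s = (x, x')" "t = (y, y')" "x \<in> pverts G" "y \<in> pverts G"
    "x' \<in> pverts H" "y' \<in> pverts H" "x \<noteq> y \<or> x' \<noteq> y'"
    by (cases s; cases t) auto
  have wf: "pair_wf_digraph G" "pair_wf_digraph H"
    using G H by (simp_all add: pair_digraph.pair_wf_digraph)
  have "\<exists>A. linking_family ({..<p} <+> {..<q}) A (parcs (G \<box> H)) s t"
  proof (cases "x = y \<or> x' = y'")
    case False
    then have "x \<noteq> y" "x' \<noteq> y'" by simp_all
    then show ?thesis
      unfolding st(1,2) using linking_family_cart_prod_skew[OF G H p q st(3,4) _ st(5,6)] by simp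
  next
    case True
    show ?thesis
    proof (cases "x' = y'")
      case True
      obtain d where "d \<in> pverts H" "x' \<noteq> d" using card_ge_2_obtain_other[OF cardH] by blast
      with True st show ?thesis
        using linking_family_cart_prod_same_row[OF G H p q(1) st(3,4) _ st(5)] by simp
    next
      case False
      with \<open>x = y \<or> x' = y'\<close> have [simp]: "y = x" by simp
      obtain d where "d \<in> pverts G" "x \<noteq> d" using card_ge_2_obtain_other[OF cardG] by blast
      then obtain A where "linking_family ({..<q} <+> {..<p}) A (parcs (H \<box> G)) (x', x) (y', x)"
        using linking_family_cart_prod_same_row[OF H G q p(1) st(5,6) False st(3)] by blast
      from linking_family_cart_prod_swap[OF wf this] obtain A' where
        A': "linking_family ({..<q} <+> {..<p}) A' (parcs (G \<box> H)) s t"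
        using st by auto
      have "bij_betw (case_sum Inr Inl) ({..<p} <+> {..<q}) ({..<q} <+> {..<p})"
        by (rule bij_betwI[of _ _ _ "case_sum Inr Inl"]) (auto split: sum.splits)
      from linking_family_bij[OF A' this] show ?thesis by blast
    qed
  qed
  then obtain A where "linking_family ({..<p} <+> {..<q}) A (parcs (G \<box> H)) s t" ..
  then show "\<exists>A. linking_family {..<p + q} A (parcs (G \<box> H)) s t"
    by (rule linking_family_reindex) (simp_all add: card_Plus)
qed


section \<open>Bounds for \<open>\<lambda>\<^sub>2\<close>\<close>

text \<open>Every vertex on the way from \<open>u\<close> to \<open>v\<close> is reached from
  \<open>x\<close> and, via \<open>v\<close>, reaches \<open>x\<close>. The walk therefore never
  leaves the strong component \<open>W\<close> of \<open>x\<close>.\<close>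

lemma rtrancl_on_mutually_reachable:
  assumes "(u, v) \<in> A\<^sup>*" and "(x, u) \<in> A\<^sup>*" and "(v, x) \<in> A\<^sup>*"
  defines "W \<equiv> {w. mutually_reachable A x w}"
  shows "(u, v) \<in> rtrancl_on W (A \<inter> W \<times> W)"
  using assms(1,2)
proof (induction rule: converse_rtrancl_induct)
  case base
  then show ?case using assms(3) by (simp add: W_def mutually_reachable_def)
next
  case (step u w)
  then have "(x, w) \<in> A\<^sup>*" by simp
  with step.IH have IH: "(w, v) \<in> rtrancl_on W (A \<inter> W \<times> W)" by simp
  have "(w, x) \<in> A\<^sup>*" using step.hyps(2) assms(3) by simp
  then have "(u, x) \<in> A\<^sup>*"
    using step.hyps(1) by (simp add: converse_rtrancl_into_rtrancl)
  then have "u \<in> W" "w \<in> W"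
    using step.prems \<open>(x, w) \<in> A\<^sup>*\<close> \<open>(w, x) \<in> A\<^sup>*\<close>
    by (simp_all add: W_def mutually_reachable_def)
  with step.hyps(1) show ?case
    by (intro converse_rtrancl_on_into_rtrancl_on[OF _ IH]) auto
qed

text \<open>The strong component of \<open>x\<close> in the digraph with arc set \<open>A\<close> is the desired subgraph.\<close>

lemma mutually_reachable_imp_strong_subgraph:
  assumes "pair_wf_digraph D" and "A \<subseteq> parcs D" and "x \<in> pverts D" and "mutually_reachable A x y"
  shows "\<exists>K. strong_subgraph {x, y} D K \<and> parcs K \<subseteq> A"
proof -
  interpret pair_wf_digraph D by fact
  define W where "W = {w. mutually_reachable A x w}"
  define K where "K = \<lparr> pverts = W, parcs = A \<inter> W \<times> W \<rparr>"
  have "W \<subseteq> pverts D"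
  proof
    fix w assume "w \<in> W"
    then have "(x, w) \<in> A\<^sup>*" by (simp add: W_def mutually_reachable_def)
    then show "w \<in> pverts D" using assms(2,3) wellformed'(2) by (cases rule: rtranclE) auto
  qed
  moreover have "pair_wf_digraph K"
    by unfold_locales (auto simp: K_def)
  ultimately have "subgraph (with_proj K) (with_proj D)"
    using assms(1,2) by (auto simp: subgraph_def K_def wf_digraph_wp_iff compatible_def)
  moreover have xy: "x \<in> W" "y \<in> W"
    using assms(4) by (auto simp: W_def mutually_reachable_def)
  moreover have "(u, v) \<in> rtrancl_on W (A \<inter> W \<times> W)" if "u \<in> W" "v \<in> W" for u v
  proof -
    have "mutually_reachable A u v"
      using that mutually_reachable_sym mutually_reachable_trans unfolding W_def by fast
    with that show ?thesis
      unfolding W_def by (intro rtrancl_on_mutually_reachable) (auto simp: mutually_reachable_def)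
  qed
  ultimately have "strong_subgraph {x, y} D K"
    by (auto simp: strong_subgraph_def strongly_connected_def reachable_def K_def)
  then show ?thesis by (auto simp: K_def)
qed

lemma strong_subgraph_imp_mutually_reachable:
  assumes "strong_subgraph S D K" and "x \<in> S" and "y \<in> S"
  shows "mutually_reachable (parcs K) x y"
proof -
  have on: "(u, v) \<in> R\<^sup>*" if "(u, v) \<in> rtrancl_on V R" for u v :: 'a and V R
    using that by induction (auto intro: rtrancl_into_rtrancl)
  have "x \<rightarrow>\<^sup>*\<^bsub>with_proj K\<^esub> y" "y \<rightarrow>\<^sup>*\<^bsub>with_proj K\<^esub> x"
    using assms by (auto simp: strong_subgraph_def strongly_connected_def)
  then show ?thesis
    using on by (auto simp: reachable_def mutually_reachable_def)
qed

text \<open>The family is indexed by its own members, with \<open>parcs\<close> as the map to arc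
  sets. Choosing for each member an arc out of \<open>v\<close> embeds the family into the
  out-neighbours of \<open>v\<close>.\<close>

lemma card_arc_disjoint_strong_family_le:
  assumes "arc_disjoint_strong_family S D F" and "v \<in> S" and "w \<in> S" and "v \<noteq> w"
    and "finite (parcs D)"
  shows "card F \<le> card (parcs D `` {v})"
proof -
  have "linking_family F parcs (parcs D) v w"
    unfolding linking_family_def
  proof (intro conjI ballI)
    show "disjoint_family_on parcs F"
      using assms(1)
      by (auto simp: arc_disjoint_strong_family_def disjoint_family_on_def pairwise_def)
  next
    fix K assume "K \<in> F"
    then have K: "strong_subgraph S D K"
      using assms(1) by (simp add: arc_disjoint_strong_family_def)
    then show "parcs K \<subseteq> parcs D" by (simp add: strong_subgraph_def subgraph_def)
    show "mutually_reachable (parcs K) v w"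
      using strong_subgraph_imp_mutually_reachable[OF K assms(2,3)] .
  qed
  then obtain a where a: "inj_on a F" "\<forall>K\<in>F. (v, a K) \<in> parcs K" "\<forall>K\<in>F. parcs K \<subseteq> parcs D"
    using linking_family_distinct_neighbours[OF _ assms(4)] unfolding linking_family_def by metis
  then have "a ` F \<subseteq> parcs D `` {v}" by blast
  moreover have "finite (parcs D `` {v})" using assms(5) by (rule finite_Image)
  ultimately show ?thesis using card_inj_on_le[OF a(1)] by blast
qed

text \<open>The \<open>Max\<close> in \<open>lambda_S\<close> carries information only over a finite
  set.\<close>

lemma finite_strong_family_cards:
  assumes "card S = 2" and "finite (parcs D)"
  shows "finite {card F | F. arc_disjoint_strong_family S D F}"
proof -
  obtain v w where "v \<in> S" "w \<in> S" "v \<noteq> w" using assms(1) by (auto simp: card_2_iff)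
  then have "{card F | F. arc_disjoint_strong_family S D F} \<subseteq> {..card (parcs D `` {v})}"
    using card_arc_disjoint_strong_family_le[of S D _ v w] assms(2) by auto
  then show ?thesis by (rule finite_subset) simp
qed

lemma lambda_S_le_out_degree:
  assumes "card S = 2" and "v \<in> S" and "finite (parcs D)"
  shows "lambda_S S D \<le> card (parcs D `` {v})"
proof -
  obtain w where w: "w \<in> S" "v \<noteq> w" using assms(1,2) by (auto simp: card_2_iff)
  \<comment> \<open>The empty family shows that the maximum is over a nonempty set.\<close>
  have "arc_disjoint_strong_family S D {}" by (simp add: arc_disjoint_strong_family_def)
  then have "{card F | F. arc_disjoint_strong_family S D F} \<noteq> {}" by blast
  then show ?thesis
    unfolding lambda_S_def
    using finite_strong_family_cards[OF assms(1,3)]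
      card_arc_disjoint_strong_family_le[OF _ assms(2) w assms(3)]
    by (subst Max_le_iff) auto
qed

lemma lambda_S_ge:
  assumes "pair_wf_digraph D" and "finite (parcs D)" and "x \<in> pverts D" and "x \<noteq> y"
    and A: "linking_family {..<k} A (parcs D) x y"
  shows "k \<le> lambda_S {x, y} D"
proof -
  have "\<forall>i<k. \<exists>K. strong_subgraph {x, y} D K \<and> parcs K \<subseteq> A i"
    using A mutually_reachable_imp_strong_subgraph[OF assms(1) _ assms(3)]
    by (simp add: linking_family_def)
  then obtain K where K: "\<And>i. i < k \<Longrightarrow> strong_subgraph {x, y} D (K i) \<and> parcs (K i) \<subseteq> A i"
    by metis
  have dis: "parcs (K i) \<inter> parcs (K j) = {}" if "i < k" "j < k" "i \<noteq> j" for i j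
  proof -
    have "A i \<inter> A j = {}"
      using A that by (simp add: linking_family_def disjoint_family_on_def)
    then show ?thesis using K that by blast
  qed
  \<comment> \<open>Families are sets of subgraphs, so \<open>k\<close> different members are
    needed. Disjoint nonempty arc sets keep the \<open>K i\<close> apart, and
    \<open>x \<noteq> y\<close> makes them nonempty.\<close>
  have ne: "parcs (K i) \<noteq> {}" if "i < k" for i
    using rtrancl_leaving_arc[of x y "parcs (K i)"] assms(4) K[OF that]
      strong_subgraph_imp_mutually_reachable[of "{x, y}" D "K i" x y]
    by (auto simp: mutually_reachable_def)
  have "inj_on K {..<k}"
    using dis ne by (intro inj_onI) (metis Int_absorb lessThan_iff)
  then have "card (K ` {..<k}) = k" by (simp add: card_image)
  moreover have "arc_disjoint_strong_family {x, y} D (K ` {..<k})"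
    unfolding arc_disjoint_strong_family_def
  proof
    show "pairwise (\<lambda>H H'. parcs H \<inter> parcs H' = {}) (K ` {..<k})"
      using dis by (intro pairwiseI) (metis imageE lessThan_iff)
  qed (use K in simp)
  ultimately have "k \<in> {card F | F. arc_disjoint_strong_family {x, y} D F}" by force
  then show ?thesis
    unfolding lambda_S_def using finite_strong_family_cards[of "{x, y}" D] assms(2,4) by simp
qed

lemma finite_lambda_S_values:
  "finite (pverts D) \<Longrightarrow> finite {lambda_S S D | S. S \<subseteq> pverts D \<and> card S = 2}"
  using finite_subset[of "{lambda_S S D | S. S \<subseteq> pverts D \<and> card S = 2}"
      "(\<lambda>S. lambda_S S D) ` Pow (pverts D)"] by blast

lemma lambda2_le_out_degree:
  assumes "pair_fin_digraph D" and "2 \<le> card (pverts D)" and "v \<in> pverts D"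
  shows "lambda2 D \<le> card (parcs D `` {v})"
proof -
  interpret pair_fin_digraph D by fact
  obtain w where w: "w \<in> pverts D" "v \<noteq> w" using card_ge_2_obtain_other[OF assms(2)] by blast
  then have "lambda_S {v, w} D \<in> {lambda_S S D | S. S \<subseteq> pverts D \<and> card S = 2}"
    using assms(3) by (intro CollectI exI[of _ "{v, w}"]) simp
  then have "lambda2 D \<le> lambda_S {v, w} D"
    unfolding lambda2_def using finite_lambda_S_values[OF pair_finite_verts] by simp
  also have "\<dots> \<le> card (parcs D `` {v})"
    using w pair_finite_arcs by (intro lambda_S_le_out_degree) simp_all
  finally show ?thesis .
qed

lemma lambda2_ge:
  assumes "pair_fin_digraph D" and "2 \<le> card (pverts D)" and "arc_linked k D"
  shows "k \<le> lambda2 D"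
proof -
  interpret pair_fin_digraph D by fact
  have wf: "pair_wf_digraph D" by unfold_locales
  obtain S where "S \<subseteq> pverts D" "card S = 2"
    using obtain_subset_with_card_n[OF assms(2)] by metis
  then have "{lambda_S S D | S. S \<subseteq> pverts D \<and> card S = 2} \<noteq> {}" by blast
  moreover have "k \<le> lambda_S S D" if sub: "S \<subseteq> pverts D" and card: "card S = 2" for S
  proof -
    obtain x y where S: "S = {x, y}" "x \<noteq> y" using card by (auto simp: card_2_iff)
    then obtain A where "linking_family {..<k} A (parcs D) x y"
      using assms(3) sub unfolding arc_linked_def by auto
    then show ?thesis
      unfolding S(1) using lambda_S_ge[OF wf pair_finite_arcs] S sub by simp
  qed
  ultimately show ?thesis
    unfolding lambda2_def using finite_lambda_S_values[OF pair_finite_verts]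
    by (subst Min_ge_iff) auto
qed

text \<open>Lower and upper bound in one notion. The inequality at \<open>v\<close> is in fact an
  equality, since the \<open>k\<close> arc sets linking \<open>v\<close> to another vertex leave it
  by different arcs.\<close>

definition degree_tight :: "nat \<Rightarrow> 'a pair_pre_digraph \<Rightarrow> bool" where
  "degree_tight k D \<longleftrightarrow> pair_digraph D \<and> 2 \<le> card (pverts D) \<and> 1 \<le> k \<and> arc_linked k D \<and>
     (\<exists>v\<in>pverts D. card (parcs D `` {v}) \<le> k)"

text \<open>The lower bound is the linking theorem for products. For the upper bound take
  \<open>(v, w)\<close> with \<open>v\<close> and \<open>w\<close> witnessing tightness: its
  out-neighbours are those of \<open>v\<close> in its row and those of \<open>w\<close> in its
  column.\<close>

theorem lambda2_cart_prod:
  assumes "degree_tight p G" and "degree_tight q H"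
  shows "lambda2 (G \<box> H) = p + q"
proof (rule antisym)
  interpret G: pair_digraph G using assms by (simp add: degree_tight_def)
  interpret H: pair_digraph H using assms by (simp add: degree_tight_def)
  note wf = G.pair_wf_digraph H.pair_wf_digraph
  interpret GH: pair_wf_digraph "G \<box> H" by (rule pair_wf_digraph_cart_prod)
  have "finite (pverts (G \<box> H))" using G.pair_finite_verts H.pair_finite_verts by simp
  moreover have "parcs (G \<box> H) \<subseteq> pverts (G \<box> H) \<times> pverts (G \<box> H)"
    using GH.wellformed' by auto
  ultimately have "finite (parcs (G \<box> H))" using finite_subset by blast
  with \<open>finite (pverts (G \<box> H))\<close> have fin: "pair_fin_digraph (G \<box> H)" by unfold_locales
  have "card (pverts G) * 1 \<le> card (pverts (G \<box> H))"
    unfolding pverts_cart_prod card_cartesian_product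
    using assms by (intro mult_le_mono2) (simp add: degree_tight_def)
  then have card: "2 \<le> card (pverts (G \<box> H))"
    using assms unfolding degree_tight_def by linarith
  show "p + q \<le> lambda2 (G \<box> H)"
    using assms
    by (intro lambda2_ge[OF fin card] arc_linked_cart_prod) (simp_all add: degree_tight_def)
  obtain v where v: "v \<in> pverts G" "card (parcs G `` {v}) \<le> p"
    using assms by (auto simp: degree_tight_def)
  obtain w where w: "w \<in> pverts H" "card (parcs H `` {w}) \<le> q"
    using assms by (auto simp: degree_tight_def)
  have finN: "finite (parcs G `` {v})" "finite (parcs H `` {w})"
    using G.pair_finite_arcs H.pair_finite_arcs by (auto intro: finite_Image)
  have "lambda2 (G \<box> H) \<le> card (parcs (G \<box> H) `` {(v, w)})"
    using v w by (intro lambda2_le_out_degree[OF fin card]) simp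
  also have "parcs (G \<box> H) `` {(v, w)} =
      (\<lambda>a. (a, w)) ` (parcs G `` {v}) \<union> Pair v ` (parcs H `` {w})"
    using v w by (auto simp: in_parcs_cart_prod_iff[OF wf])
  also have "card \<dots> \<le> card (parcs G `` {v}) + card (parcs H `` {w})"
    using card_Un_le card_image_le[OF finN(1)] card_image_le[OF finN(2)]
    by (meson add_mono order_trans)
  finally show "lambda2 (G \<box> H) \<le> p + q" using v w by linarith
qed


section \<open>The four families\<close>

lemma arc_linked_1I:
  assumes "\<And>x y. x \<in> pverts D \<Longrightarrow> y \<in> pverts D \<Longrightarrow> (x, y) \<in> (parcs D)\<^sup>*"
  shows "arc_linked 1 D"
  using assms
  by (auto simp: arc_linked_def linking_family_def mutually_reachable_def disjoint_family_on_def
      intro!: exI[of _ "\<lambda>_. parcs D"])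

section \<open>Directed cycles\<close>

lemma pverts_dicycle [simp]: "pverts (dicycle n) = {..<n}"
  by (simp add: dicycle_def)

text \<open>The wrap-around is a case distinction instead of \<open>mod\<close>, so that claims
  about single arcs become linear arithmetic.\<close>

lemma in_parcs_dicycle_iff:
  "(i, j) \<in> parcs (dicycle n) \<longleftrightarrow> i < n \<and> j = (if Suc i = n then 0 else Suc i)"
  by (auto simp: dicycle_def)

lemma pair_digraphI:
  assumes "finite (pverts D)"
    and "\<And>u v. (u, v) \<in> parcs D \<Longrightarrow> u \<in> pverts D \<and> v \<in> pverts D \<and> u \<noteq> v"
  shows "pair_digraph D"
proof unfold_locales
  have "parcs D \<subseteq> pverts D \<times> pverts D" using assms(2) by auto
  then show "finite (parcs D)" using assms(1) finite_subset by blast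
qed (use assms in auto)

lemma dicycle_reachable:
  assumes "i < n" and "j < n"
  shows "(i, j) \<in> (parcs (dicycle n))\<^sup>*"
proof -
  have step: "(i, (i + k) mod n) \<in> (parcs (dicycle n))\<^sup>*" for k
  proof (induction k)
    case 0
    then show ?case using assms by simp
  next
    case (Suc k)
    have "((i + k) mod n, (i + Suc k) mod n) \<in> parcs (dicycle n)"
      using assms by (simp add: in_parcs_dicycle_iff mod_Suc)
    with Suc show ?case by (rule rtrancl_into_rtrancl)
  qed
  \<comment> \<open>Going \<open>n - i\<close> steps forward from \<open>i\<close> ends at 0, and
    \<open>j\<close> more end at \<open>j\<close>.\<close>
  show ?thesis using step[of "n - i + j"] assms by simp
qed

lemma degree_tight_dicycle:
  assumes "2 \<le> n"
  shows "degree_tight 1 (dicycle n)"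
proof -
  have "parcs (dicycle n) `` {0} = {1}" using assms by (auto simp: in_parcs_dicycle_iff)
  moreover have "pair_digraph (dicycle n)"
    using assms by (intro pair_digraphI) (auto simp: in_parcs_dicycle_iff split: if_splits)
  moreover have "arc_linked 1 (dicycle n)"
    by (rule arc_linked_1I) (simp add: dicycle_reachable)
  ultimately show ?thesis
    using assms unfolding degree_tight_def by (intro conjI bexI[of _ 0]) simp_all
qed

section \<open>Symmetric cycles\<close>

lemma pverts_sym_cycle [simp]: "pverts (sym_cycle n) = {..<n}"
  by (simp add: sym_cycle_def)

lemma parcs_sym_cycle: "parcs (sym_cycle n) = parcs (dicycle n) \<union> (parcs (dicycle n))\<inverse>"
  unfolding sym_cycle_def parcs_mk_symmetric by force

lemma degree_tight_sym_cycle: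
  assumes "3 \<le> n"
  shows "degree_tight 2 (sym_cycle n)"
proof -
  let ?C = "parcs (dicycle n)"
  \<comment> \<open>The two orientations of the cycle are the two arc sets. They are disjoint
    because \<open>3 \<le> n\<close>; for two vertices they would coincide.\<close>
  have dis: "?C \<inter> ?C\<inverse> = {}"
    using assms by (auto simp: in_parcs_dicycle_iff split: if_splits)
  have "linking_family {..<2} (\<lambda>i. if i = (0::nat) then ?C else ?C\<inverse>) (parcs (sym_cycle n)) x y"
    if "x < n" "y < n" for x y
    using dicycle_reachable[OF that] dicycle_reachable[OF that(2,1)] dis
    by (auto simp: linking_family_def disjoint_family_on_def parcs_sym_cycle
        mutually_reachable_def rtrancl_converse)
  then have "arc_linked 2 (sym_cycle n)" unfolding arc_linked_def by auto
  moreover have "pair_digraph (sym_cycle n)"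
    using assms
    by (intro pair_digraphI) (auto simp: parcs_sym_cycle in_parcs_dicycle_iff split: if_splits)
  moreover have "parcs (sym_cycle n) `` {0} \<subseteq> {1, n - 1}"
    using assms by (auto simp: parcs_sym_cycle in_parcs_dicycle_iff split: if_splits)
  then have "card (parcs (sym_cycle n) `` {0}) \<le> card {1, n - 1}" by (intro card_mono) auto
  then have "card (parcs (sym_cycle n) `` {0}) \<le> 2"
    using card_insert_le_m1[of 2 "{n - 1}" 1] by simp
  ultimately show ?thesis
    using assms unfolding degree_tight_def by (intro conjI bexI[of _ 0]) simp_all
qed

section \<open>Complete digraphs\<close>

lemma pverts_sym_complete [simp]: "pverts (sym_complete n) = {..<n}"
  by (simp add: sym_complete_def)

lemma degree_tight_sym_complete:
  assumes "2 \<le> n"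
  shows "degree_tight (n - 1) (sym_complete n)"
proof -
  have "\<exists>A. linking_family {..<n - 1} A (parcs (sym_complete n)) x y"
    if "x < n" "y < n" "x \<noteq> y" for x y
  proof (rule linking_family_reindex)
    \<comment> \<open>One two-way route from \<open>x\<close> through each vertex
      \<open>a \<noteq> x\<close> to \<open>y\<close>. For \<open>a = y\<close>, removing
      \<open>Id\<close> leaves just the two arcs between \<open>x\<close> and
      \<open>y\<close>.\<close>
    let ?A = "\<lambda>a. {(x, a), (a, x), (a, y), (y, a)} - Id"
    have "mutually_reachable (?A a) x y" if "a \<in> {..<n} - {x}" for a
    proof -
      have "mutually_reachable (?A a) x a"
        using that by (auto simp: mutually_reachable_def)
      also have "mutually_reachable (?A a) a y"
        by (cases "a = y") (auto simp: mutually_reachable_def)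
      finally show ?thesis .
    qed
    then show "linking_family ({..<n} - {x}) ?A (parcs (sym_complete n)) x y"
      using that by (auto simp: linking_family_def disjoint_family_on_def sym_complete_def)
  qed (use that in simp_all)
  then have "arc_linked (n - 1) (sym_complete n)"
    by (simp add: arc_linked_def)
  moreover have "parcs (sym_complete n) `` {0} = {..<n} - {0}"
    using assms by (auto simp: sym_complete_def)
  then have "card (parcs (sym_complete n) `` {0}) = n - 1" using assms by simp
  moreover have "pair_digraph (sym_complete n)"
    by (rule pair_digraphI) (auto simp: sym_complete_def)
  ultimately show ?thesis
    using assms unfolding degree_tight_def by (intro conjI bexI[of _ 0]) simp_all
qed

section \<open>Trees\<close>

text \<open>The start vertex of a longest path is a leaf: all its neighbours lie on the path, and any one
  other than the second vertex of the path would close a cycle.\<close>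

lemma sym_tree_leaf:
  assumes T: "sym_tree n T" and "2 \<le> n"
  shows "\<exists>v\<in>pverts T. card (parcs T `` {v}) \<le> 1"
proof -
  interpret pair_graph T using T by (simp add: sym_tree_def)
  have sym: "(v, u) \<in> parcs T" if "(u, v) \<in> parcs T" for u v
    using that pair_sym_arcs by (auto simp: symmetric_def sym_def)
  have "pverts T \<noteq> {}" using assms by (auto simp: sym_tree_def)
  then obtain r where "r \<in> pverts T" by blast
  define L where "L l \<longleftrightarrow> (\<exists>u p v. apath u p v \<and> length p = l)" for l
  have "apath r [] r" using \<open>r \<in> pverts T\<close> by (simp add: apath_Nil_iff)
  then have "L 0" unfolding L_def by force
  moreover have "\<forall>l. L l \<longrightarrow> l \<le> card (pverts T)"
    using length_apath by (auto simp: L_def)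
  ultimately obtain l where l: "L l" "\<And>l'. L l' \<Longrightarrow> l' \<le> l"
    using ex_has_greatest_nat[of L 0 id "Suc (card (pverts T))"]
    by (auto simp: less_Suc_eq_le)
  then obtain u p v where p: "apath u p v" "length p = l" by (auto simp: L_def)
  have awalk: "awalk u p v" and dist: "distinct (awalk_verts u p)"
    using p(1) by (auto simp: apath_def)
  have u: "u \<in> pverts T" using awalk by (auto simp: awalk_def)
  \<comment> \<open>If \<open>p\<close> is empty its head is arbitrary, but then \<open>u\<close>
    has no out-neighbour, since one would give a longer path.\<close>
  have "w = snd (hd p)" if w: "(u, w) \<in> parcs T" for w
  proof (rule ccontr)
    assume neq: "w \<noteq> snd (hd p)"
    have wu: "(w, u) \<in> parcs T" using sym w .
    have "w \<noteq> u" using no_loops'[OF w] by simp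
    have "w \<in> set (awalk_verts u p)"
    proof (rule ccontr)
      assume "w \<notin> set (awalk_verts u p)"
      then have "apath w ((w, u) # p) v"
        using p(1) wu by (simp add: apath_Cons_iff)
      then have "L (Suc l)" using p(2) unfolding L_def by fastforce
      then show False using l(2) by fastforce
    qed
    then obtain q q' where q: "p = q @ q'" "awalk u q w"
      using awalk_decomp[OF awalk] by blast
    then obtain e q1 where "q = e # q1"
      using \<open>w \<noteq> u\<close> by (cases q) (auto simp: awalk_Nil_iff)
    \<comment> \<open>If \<open>q\<close> were a single arc, it would be the first arc of
      \<open>p\<close> and \<open>w\<close> its head, against \<open>neq\<close>. With the arc back
      from \<open>w\<close> to \<open>u\<close> the closed walk thus has at least three
      arcs.\<close>
    moreover then have "q1 \<noteq> []" using q neq by (auto simp: awalk_simps)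
    ultimately have "3 \<le> length ((w, u) # q)" by (cases q1) auto
    moreover have "distinct (awalk_verts u q)"
      using p(1) unfolding q(1) apath_append_iff by (simp add: apath_def)
    with q(2) wu have "cycle ((w, u) # q)"
      unfolding cycle_def by (intro exI[of _ w]) (auto simp: awalk_Cons_iff)
    ultimately show False using T by (auto simp: sym_tree_def)
  qed
  then have "parcs T `` {u} \<subseteq> {snd (hd p)}" by blast
  then have "card (parcs T `` {u}) \<le> 1" using card_mono[of "{snd (hd p)}"] by simp
  with u show ?thesis by blast
qed

lemma degree_tight_sym_tree:
  assumes T: "sym_tree n T" and "2 \<le> n"
  shows "degree_tight 1 T"
proof -
  interpret pair_graph T using T by (simp add: sym_tree_def)
  have "(x, y) \<in> (parcs T)\<^sup>*" if "x \<in> pverts T" "y \<in> pverts T" for x y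
  proof -
    \<comment> \<open>\<open>connected\<close> refers to the symmetric closure, which has the same
      reachability as \<open>T\<close> because \<open>T\<close> is symmetric.\<close>
    have "strongly_connected (with_proj (mk_symmetric (with_proj T)))"
      using T by (simp add: sym_tree_def connected_def)
    then have "x \<rightarrow>\<^sup>*\<^bsub>with_proj (mk_symmetric (with_proj T))\<^esub> y"
      using that by (auto simp: strongly_connected_def)
    then have "x \<rightarrow>\<^sup>*\<^bsub>with_proj T\<^esub> y"
      using reachable_mk_symmetric_eq[OF pair_sym_arcs] by simp
    then show ?thesis
      by (induction rule: reachable_induct) (auto intro: rtrancl_into_rtrancl)
  qed
  then have "arc_linked 1 T" by (rule arc_linked_1I)
  then show ?thesis
    using sym_tree_leaf[OF assms] assms pair_digraph
    by (auto simp: degree_tight_def sym_tree_def)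
qed


theorem theorem5p5:
  fixes n m :: nat
  assumes "2 \<le> n" and "2 \<le> m"
  shows
    "(lambda2 (dicycle n \<box> dicycle m) = 2 \<and>
      (3 \<le> m \<longrightarrow> lambda2 (dicycle n \<box> sym_cycle m) = 3) \<and>
      (\<forall>T :: 'b pair_pre_digraph. sym_tree m T \<longrightarrow> lambda2 (dicycle n \<box> T) = 2) \<and>
      lambda2 (dicycle n \<box> sym_complete m) = m) \<and>
     ((3 \<le> n \<longrightarrow> lambda2 (sym_cycle n \<box> dicycle m) = 3) \<and>
      (3 \<le> n \<and> 3 \<le> m \<longrightarrow> lambda2 (sym_cycle n \<box> sym_cycle m) = 4) \<and>
      (\<forall>T :: 'b pair_pre_digraph. 3 \<le> n \<and> sym_tree m T \<longrightarrow> lambda2 (sym_cycle n \<box> T) = 3) \<and>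
      (3 \<le> n \<longrightarrow> lambda2 (sym_cycle n \<box> sym_complete m) = m + 1)) \<and>
     ((\<forall>T :: 'a pair_pre_digraph. sym_tree n T \<longrightarrow> lambda2 (T \<box> dicycle m) = 2) \<and>
      (\<forall>T :: 'a pair_pre_digraph. 3 \<le> m \<and> sym_tree n T \<longrightarrow> lambda2 (T \<box> sym_cycle m) = 3) \<and>
      (\<forall>(T :: 'a pair_pre_digraph) (T' :: 'b pair_pre_digraph).
         sym_tree n T \<and> sym_tree m T' \<longrightarrow> lambda2 (T \<box> T') = 2) \<and>
      (\<forall>T :: 'a pair_pre_digraph. sym_tree n T \<longrightarrow> lambda2 (T \<box> sym_complete m) = m)) \<and>
     (lambda2 (sym_complete n \<box> dicycle m) = n \<and>
      (3 \<le> m \<longrightarrow> lambda2 (sym_complete n \<box> sym_cycle m) = n + 1) \<and>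
      (\<forall>T :: 'b pair_pre_digraph. sym_tree m T \<longrightarrow> lambda2 (sym_complete n \<box> T) = n) \<and>
      lambda2 (sym_complete n \<box> sym_complete m) = n + m - 2)"
proof -
  have D: "degree_tight 1 (dicycle n)" "degree_tight 1 (dicycle m)"
    "degree_tight (n - 1) (sym_complete n)" "degree_tight (m - 1) (sym_complete m)"
    using assms by (simp_all only: degree_tight_dicycle degree_tight_sym_complete)
  have C: "3 \<le> n \<Longrightarrow> degree_tight 2 (sym_cycle n)" "3 \<le> m \<Longrightarrow> degree_tight 2 (sym_cycle m)"
    by (simp_all only: degree_tight_sym_cycle)
  have T: "\<And>T :: 'a pair_pre_digraph. sym_tree n T \<Longrightarrow> degree_tight 1 T"
    "\<And>T :: 'b pair_pre_digraph. sym_tree m T \<Longrightarrow> degree_tight 1 T"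
    using degree_tight_sym_tree assms by blast+
  \<comment> \<open>Each value is a sum of two of the numbers 1, 2, 1 and order minus one. As
    \<open>n\<close> and \<open>m\<close> are at least 2, the natural subtractions in sums such as
    \<open>1 + (m - 1) = m\<close> lose nothing.\<close>
  show ?thesis
    using assms by (auto simp:lambda2_cart_prod[OF D(1) D(2)] lambda2_cart_prod[OF D(1) C(2)]
        lambda2_cart_prod[OF D(1) T(2)] lambda2_cart_prod[OF D(1) D(4)]
        lambda2_cart_prod[OF C(1) D(2)] lambda2_cart_prod[OF C(1) C(2)]
        lambda2_cart_prod[OF C(1) T(2)] lambda2_cart_prod[OF C(1) D(4)]
        lambda2_cart_prod[OF T(1) D(2)] lambda2_cart_prod[OF T(1) C(2)]
        lambda2_cart_prod[OF T(1) T(2)] lambda2_cart_prod[OF T(1) D(4)]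
        lambda2_cart_prod[OF D(3) D(2)] lambda2_cart_prod[OF D(3) C(2)]
        lambda2_cart_prod[OF D(3) T(2)] lambda2_cart_prod[OF D(3) D(4)])
qed

end
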